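(* Consider the plant, reference model and standing assumptions described in the context. Let $\mu>0$, $0<\beta<2$, $0<\gamma<\sqrt{\frac{2-\beta}{\beta}}$, and suppose that $$\alpha := 2(1-\gamma)-\frac{\gamma(2-3\beta)^2}{\beta\left(2-(1+\gamma^2)\beta\right)} > 0 .$$ Then, for every choice of initial states $x_{p0},x_{m0}\in\mathbb{R}^n$, every initial parameter estimate $\hat\Theta_0\in\mathbb{R}^{m\times(n+p)}$ and every reference input $\{r_k\}_{k\ge 0}\subset\mathbb{R}^m$ with $\|r_k\|\le r_{max}$ for all $k$ (for some finite $r_{max}$), the closed-loop system obtained by applying to the plant the adaptive controller with the high-order tuner update law (with gains $\mu,\gamma,\beta$) described in the context satisfies $$\lim_{k\to\infty}\|e_k\| = 0, \qquad e_k := x_{pk}-x_{mk}.$$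
   Context: Norms: $\|\cdot\|$ is the Euclidean norm on vectors. Plant: for $k\ge 0$, $$x_{p(k+1)} = A_p x_{pk} + B\Big(\sum_{i=1}^p a_i f_i(x_{pk}) + u_k\Big),$$ with state $x_{pk}\in\mathbb{R}^n$, input $u_k\in\mathbb{R}^m$, $A_p\in\mathbb{R}^{n\times n}$ and $a_1,\dots,a_p\in\mathbb{R}^m$ (unknown to the controller), $B\in\mathbb{R}^{n\times m}$ and $f_1,\dots,f_p:\mathbb{R}^n\to\mathbb{R}$ (known). Reference model: $x_{m(k+1)} = A_m x_{mk} + B r_k$, where $A_m\in\mathbb{R}^{n\times n}$ is Schur-stable (all eigenvalues strictly inside the unit circle) and $r_k\in\mathbb{R}^m$ is the reference input. Standing assumptions: (i) the pair $(A_p,B)$ is controllable and the columns of $B$ are linearly independent; (ii) each $f_i$ is globally $M_i$-Lipschitz with $f_i(0)=0$; (iii) (matching condition) there exists $K_*\in\mathbb{R}^{m\times n}$ with $A_m = A_p + BK_*$. Adaptive controller: the parameter estimate is $\hat\Theta_k\in\mathbb{R}^{m\times(n+p)}$ and there is an auxiliary estimate $\hat\Xi_k\in\mathbb{R}^{m\times(n+p)}$, initialized by $\hat\Xi_0=\hat\Theta_0$. At each step $k=0,1,2,\dots$: 1. The regressor is $\phi_k = [x_{pk}^\top, -f_1(x_{pk}),\dots,-f_p(x_{pk})]^\top\in\mathbb{R}^{n+p}$, and the input applied to the plant is $u_k = \hat\Theta_k\phi_k + r_k$. 2. The new plant state $x_{p(k+1)}$ and reference state $x_{m(k+1)}$ are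 obtained, $e_{k+1}=x_{p(k+1)}-x_{m(k+1)}$, and the prediction error is $$\varepsilon_{k+1} = (B^\top B)^{-1}B^\top(e_{k+1}-A_m e_k).$$ 3. (High-order tuner update.) With $N_k=\max\{\mu,\|\phi_k\|^2\}$, set $$\bar\Theta_k = \hat\Theta_k - \frac{\gamma\beta}{N_k}\,\varepsilon_{k+1}\phi_k^\top,$$ $$\hat\Theta_{k+1} = \bar\Theta_k - \beta(\bar\Theta_k-\hat\Xi_k),$$ $$\hat\Xi_{k+1} = \hat\Xi_k - \frac{\gamma}{N_k}\big((\hat\Theta_{k+1}-\hat\Theta_k)\phi_k+\varepsilon_{k+1}\big)\phi_k^\top .$$ *)

theory Defs
  imports "HOL-Analysis.Analysis"
begin

text \<open>The eigenvalues of a real matrix are its complex ones, hence the passage to \<open>complex\<close>.\<close>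

definition eigenvalue_of :: "complex^'n^'n \<Rightarrow> complex \<Rightarrow> bool" where
  "eigenvalue_of A l \<longleftrightarrow> (\<exists>v. v \<noteq> 0 \<and> A *v v = l *s v)"

definition schur_stable :: "real^'n^'n \<Rightarrow> bool" where
  "schur_stable A \<longleftrightarrow> (\<forall>l. eigenvalue_of (map_matrix complex_of_real A) l \<longrightarrow> cmod l < 1)"

primrec linear_state ::
  "real^'n^'n \<Rightarrow> real^'m^'n \<Rightarrow> (nat \<Rightarrow> real^'m) \<Rightarrow> real^'n \<Rightarrow> nat \<Rightarrow> real^'n" where
  "linear_state A B u x 0 = x"
| "linear_state A B u x (Suc k) = A *v linear_state A B u x k + B *v u k"

text \<open>Controllability is meant in the sense of steering between \<^emph>\<open>arbitrary\<close> states in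
  finite time (not merely steering to the origin, which in discrete time is weaker).\<close>

definition controllable :: "real^'n^'n \<Rightarrow> real^'m^'n \<Rightarrow> bool" where
  "controllable A B \<longleftrightarrow> (\<forall>x y. \<exists>u N. linear_state A B u x N = y)"

text \<open>Stated for the family of columns: the set \<open>columns B\<close> would not see repeated columns.\<close>

definition lin_indep_columns :: "real^'m^'n \<Rightarrow> bool" where
  "lin_indep_columns B \<longleftrightarrow>
     (\<forall>c. (\<Sum>j\<in>UNIV. c j *s column j B) = 0 \<longrightarrow> (\<forall>j. c j = 0))"

text \<open>The matrix \<open>v w\<^sup>T\<close>.\<close>

definition outer :: "real^'m \<Rightarrow> real^'q \<Rightarrow> real^'q^'m" where
  "outer v w = (\<chi> i j. v $ i * w $ j)"

text \<open>Vectors with \<open>n + p\<close> entries are indexed by the sum type \<open>'n + 'p\<close>: the \<open>Inl\<close> entries hold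
  the state, the \<open>Inr\<close> entries the negated nonlinearities.\<close>

definition regressor :: "('p::finite \<Rightarrow> real^'n \<Rightarrow> real) \<Rightarrow> real^'n \<Rightarrow> real^('n + 'p)" where
  "regressor f x = (\<chi> s. case s of Inl i \<Rightarrow> x $ i | Inr j \<Rightarrow> - f j x)"

end

theory Submission
  imports Defs "HOL-Computational_Algebra.Fundamental_Theorem_Algebra"
begin

text \<open>
  Let \<open>S = [K, a\<^sub>1, \<dots>, a\<^sub>p]\<close> be the ideal parameter provided by the matching condition.  Substituting
  \<open>A\<^sub>p = A\<^sub>m - B K\<close> into the plant shows that the tracking error obeys
  \<open>e\<^sub>k\<^sub>+\<^sub>1 = A\<^sub>m e\<^sub>k + B \<epsilon>\<^sub>k\<^sub>+\<^sub>1\<close> with \<open>\<epsilon>\<^sub>k\<^sub>+\<^sub>1 = (\<Theta>\<^sub>k - S) \<phi>\<^sub>k\<close>, and the pseudoinverse of \<open>B\<close> recovers exactly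
  this \<open>\<epsilon>\<^sub>k\<^sub>+\<^sub>1\<close> from the measured errors.  Since \<open>A\<^sub>m\<close> is stable, it is enough that \<open>\<epsilon>\<close> becomes small
  compared with the state.

  The update law is a Nesterov-type scheme for the normalized squared prediction error.
  The energy \<open>V\<^sub>k = \<parallel>\<Xi>\<^sub>k - S\<parallel>\<^sup>2 + \<parallel>\<Theta>\<^sub>k - \<Xi>\<^sub>k\<parallel>\<^sup>2\<close> decreases by at least a fixed multiple of
  \<open>\<parallel>\<epsilon>\<^sub>k\<^sub>+\<^sub>1\<parallel>\<^sup>2 / N\<^sub>k\<close> in every step (\<open>tuner_energy_decrease\<close>); this is where the positivity of \<open>\<alpha>\<close> and the
  bound on \<open>\<gamma>\<close> enter.  As \<open>V\<close> is nonnegative, its decrements vanish, so \<open>\<parallel>\<epsilon>\<^sub>k\<^sub>+\<^sub>1\<parallel> \<le> \<tau>\<^sub>k sqrt N\<^sub>k\<close> with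
  \<open>\<tau>\<^sub>k \<rightarrow> 0\<close>.

  It remains to exclude that the state, and with it \<open>N\<close>, grows.  The regressor is at most linear in
  the plant state, and the plant state is the error plus the reference state, which is bounded because
  \<open>A\<^sub>m\<close> is stable and the reference input is bounded.  Therefore \<open>\<parallel>B \<epsilon>\<^sub>k\<^sub>+\<^sub>1\<parallel> \<le> \<eta>\<^sub>k (1 + \<parallel>e\<^sub>k\<parallel>)\<close> with
  \<open>\<eta>\<^sub>k \<rightarrow> 0\<close>, and a small-gain argument (\<open>stable_recursion_vanishes\<close>) gives convergence and boundedness
  of the error at the same time.

  The small-gain argument needs Schur stability in the quantitative form
  \<open>\<parallel>A\<^sup>k v\<parallel> \<le> C \<rho>\<^sup>k \<parallel>v\<parallel>\<close> with \<open>\<rho> < 1\<close> (\<open>schur_stable_power_bound\<close>).  It is obtained without a Jordan form or a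
  spectral radius formula: some nonzero polynomial in \<open>A\<close> kills \<open>v\<close>, the polynomial splits over
  the complex numbers, and removing a linear factor preserves geometric decay.
\<close>

section \<open>Powers of a Schur stable matrix\<close>

definition decays_under :: "complex^'n^'n \<Rightarrow> complex^'n \<Rightarrow> bool" where
  "decays_under A v \<longleftrightarrow> (\<exists>C \<rho>. 0 < \<rho> \<and> \<rho> < 1 \<and> (\<forall>k. norm (((*v) A ^^ k) v) \<le> C * \<rho> ^ k))"

text \<open>The vector \<open>p(A) v\<close>, evaluated by Horner's scheme.  Each step
  multiplies \<open>A\<close> with a vector, never with a matrix.\<close>

definition poly_action :: "complex^'n^'n \<Rightarrow> complex poly \<Rightarrow> complex^'n \<Rightarrow> complex^'n" where
  "poly_action A p v = fold_coeffs (\<lambda>c w. c *s v + A *v w) p 0"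

lemma norm_vector_smult: "norm (c *s v) = cmod c * norm v" for v :: "complex^'n"
  by (simp add: norm_vec_def norm_mult L2_set_right_distrib)

lemma of_real_smult: "complex_of_real c *s v = c *\<^sub>R v"
  by (simp add: vec_eq_iff) (simp add: scaleR_conv_of_real)

lemma matrix_power_linear:
  fixes A :: "'a::real_algebra_1^'n^'n"
  shows "linear ((*v) A ^^ k)"
proof (induction k)
  case 0
  then show ?case by (simp add: linear_id[unfolded id_def] id_def)
next
  case (Suc k)
  have "linear ((*v) A)" by (rule matrix_vector_mul_linear)
  from linear_compose[OF Suc this] show ?case by (simp add: o_def)
qed

lemma matrix_power_smult: "((*v) A ^^ k) (c *s v) = c *s ((*v) A ^^ k) v"
  for A :: "complex^'n^'n"
  by (induction k) (auto simp: vec.scale)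

lemma poly_action_0 [simp]: "poly_action A 0 v = 0"
  by (simp add: poly_action_def)

lemma poly_action_pCons [simp]:
  "poly_action A (pCons c p) v = c *s v + A *v poly_action A p v"
  by (cases "p = 0 \<and> c = 0") (auto simp: poly_action_def)

lemma poly_action_add: "poly_action A (p + q) v = poly_action A p v + poly_action A q v"
  by (induction p q rule: poly_induct2)
     (auto simp: matrix_vector_right_distrib vec.scale_left_distrib)

lemma poly_action_smult: "poly_action A (smult c p) v = c *s poly_action A p v"
  by (induction p) (auto simp: vec.scale vec.scale_right_distrib)

text \<open>This is what lets the roots of an annihilating polynomial be removed one at a time.\<close>

lemma poly_action_linear_factor:
  "poly_action A ([:-l, 1:] * q) v = A *v poly_action A q v - l *s poly_action A q v"
proof -
  have "[:-l, 1:] * q = pCons 0 q + smult (-l) q" by simp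
  then show ?thesis by (simp only: poly_action_add poly_action_smult) simp
qed

lemma poly_action_monom: "poly_action A (monom c i) v = c *s ((*v) A ^^ i) v"
  by (induction i) (auto simp: monom_0 monom_Suc vec.scale)

lemma poly_action_sum: "poly_action A (\<Sum>i\<in>I. p i) v = (\<Sum>i\<in>I. poly_action A (p i) v)"
  by (induction I rule: infinite_finite_induct) (auto simp: poly_action_add)

text \<open>Among more vectors \<open>A\<^sup>i v\<close> than the dimension, two coincide or there is a linear relation,
  and in both cases this is a polynomial that kills \<open>v\<close>.  The dimension is counted over the reals, so the relation
  even has real coefficients.\<close>

lemma annihilating_polynomial_exists:
  fixes A :: "complex^'n^'n"
  shows "\<exists>p. p \<noteq> 0 \<and> poly_action A p v = 0"
proof -
  let ?g = "\<lambda>i. ((*v) A ^^ i) v" and ?n = "DIM(complex^'n)"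
  show ?thesis
  proof (cases "inj_on ?g {..?n}")
    case False
    then obtain i j where ij: "i \<noteq> j" "?g i = ?g j"
      by (auto simp: inj_on_def)
    let ?p = "monom 1 i + monom (-1) j :: complex poly"
    have "coeff ?p i = 1" using ij by simp
    then have "?p \<noteq> 0" by (metis coeff_0 zero_neq_one)
    moreover have "poly_action A ?p v = 0"
      using ij by (simp add: poly_action_add poly_action_monom)
    ultimately show ?thesis by blast
  next
    case True
    let ?S = "?g ` {..?n}"
    have "card ?S = ?n + 1" using True by (simp add: card_image)
    then have "dependent ?S" by (intro dependent_biggerset) auto
    then obtain u where u: "\<exists>x\<in>?S. u x \<noteq> 0" "(\<Sum>x\<in>?S. u x *\<^sub>R x) = 0"
      by (subst (asm) real_vector.dependent_finite) auto
    then obtain i where i: "i \<le> ?n" "u (?g i) \<noteq> 0" by auto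
    let ?p = "\<Sum>i\<le>?n. monom (complex_of_real (u (?g i))) i"
    have "coeff ?p i = complex_of_real (u (?g i))"
      using i by (simp add: coeff_sum)
    then have "?p \<noteq> 0" using i by (metis coeff_0 of_real_eq_0_iff)
    moreover have "poly_action A ?p v = 0"
    proof -
      have "poly_action A ?p v = (\<Sum>i\<le>?n. u (?g i) *\<^sub>R ?g i)"
        by (simp add: poly_action_sum poly_action_monom of_real_smult)
      also have "\<dots> = (\<Sum>x\<in>?S. u x *\<^sub>R x)"
        using True by (simp add: sum.reindex)
      finally show ?thesis using u by simp
    qed
    ultimately show ?thesis by blast
  qed
qed

text \<open>A rate strictly between 1 and the larger of the two rates \<open>a\<close> and \<open>\<sigma>\<close> absorbs
  the resonance that appears when they coincide.\<close>

lemma geometric_bound_forced: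
  fixes w :: "nat \<Rightarrow> 'a::real_normed_vector"
  assumes step: "\<And>k. norm (w (Suc k)) \<le> a * norm (w k) + C * \<sigma> ^ k"
    and "0 \<le> a" "a < 1" "0 < \<sigma>" "\<sigma> < 1"
  shows "\<exists>D \<rho>. 0 < \<rho> \<and> \<rho> < 1 \<and> (\<forall>k. norm (w k) \<le> D * \<rho> ^ k)"
proof -
  obtain \<rho> where \<rho>: "max a \<sigma> < \<rho>" "\<rho> < 1"
    using dense[of "max a \<sigma>" 1] assms by auto
  define D where "D = norm (w 0) + \<bar>C\<bar> / (\<rho> - a)"
  have D: "\<bar>C\<bar> \<le> D * (\<rho> - a)" "norm (w 0) \<le> D"
    using \<rho> by (auto simp: D_def distrib_right)
  have "norm (w k) \<le> D * \<rho> ^ k" for k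
  proof (induction k)
    case 0
    then show ?case using D by simp
  next
    case (Suc k)
    have "C * \<sigma> ^ k \<le> \<bar>C\<bar> * \<rho> ^ k"
      using \<rho> assms by (intro mult_mono power_mono) auto
    also have "\<dots> \<le> D * (\<rho> - a) * \<rho> ^ k"
      using D \<rho> assms by (intro mult_right_mono) auto
    finally have "C * \<sigma> ^ k \<le> D * (\<rho> - a) * \<rho> ^ k" .
    moreover have "a * norm (w k) \<le> a * (D * \<rho> ^ k)"
      using Suc assms by (intro mult_left_mono) auto
    ultimately show ?case using step[of k] by (simp add: algebra_simps)
  qed
  then show ?thesis using \<rho> assms by (intro exI[of _ D] exI[of _ \<rho>]) auto
qed

text \<open>Two mechanisms, according to \<open>l\<close>.  Inside the disc, \<open>A\<^sup>k v\<close> solves the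
  recursion \<open>w\<^sub>k\<^sub>+\<^sub>1 = l w\<^sub>k + g\<^sub>k\<close> with a geometrically small \<open>g\<close>.  Outside the open
  disc, \<open>l\<close> is no eigenvalue, hence \<open>A - l\<close> has a left inverse, and that inverse carries the
  bound for \<open>A\<^sup>k (A - l) v\<close> over to \<open>A\<^sup>k v\<close>.\<close>

lemma decays_under_linear_factor:
  assumes A: "\<And>l. eigenvalue_of A l \<Longrightarrow> cmod l < 1"
    and dec: "decays_under A (A *v v - l *s v)"
  shows "decays_under A v"
proof -
  let ?T = "\<lambda>k. (*v) A ^^ k"
  obtain C \<rho> where C: "0 < \<rho>" "\<rho> < 1" "\<And>k. norm (?T k (A *v v - l *s v)) \<le> C * \<rho> ^ k"
    using dec by (auto simp: decays_under_def)
  have step: "?T k (A *v v - l *s v) = A *v ?T k v - l *s ?T k v" for k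
    by (simp add: linear_diff[OF matrix_power_linear] matrix_power_smult flip: funpow_swap1)
  show ?thesis
  proof (cases "cmod l < 1")
    case True
    have "norm (?T (Suc k) v) \<le> cmod l * norm (?T k v) + C * \<rho> ^ k" for k
    proof -
      have "norm (?T (Suc k) v) = norm (l *s ?T k v + ?T k (A *v v - l *s v))"
        by (simp add: step)
      also have "\<dots> \<le> cmod l * norm (?T k v) + norm (?T k (A *v v - l *s v))"
        by (metis norm_triangle_ineq norm_vector_smult)
      finally show ?thesis using C(3)[of k] by linarith
    qed
    from geometric_bound_forced[OF this] show ?thesis
      using True C by (simp add: decays_under_def)
  next
    case False
    let ?M = "A - mat l"
    have M: "?M *v w = A *v w - l *s w" for w
    proof -
      have "mat l *v w = l *s w"
        by (simp add: vec_eq_iff matrix_vector_mult_def mat_def if_distrib[of "\<lambda>x. x * _"]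
            cong: if_cong)
      then show ?thesis by (simp add: matrix_vector_mult_diff_rdistrib)
    qed
    have "inj ((*v) ?M)"
    proof (rule injI)
      fix x y assume "?M *v x = ?M *v y"
      then have "A *v (x - y) = l *s (x - y)"
        by (simp only: M matrix_vector_mult_diff_distrib vec.scale_right_diff_distrib)
           (simp add: algebra_simps)
      moreover have "\<not> eigenvalue_of A l" using A False by blast
      ultimately have "x - y = 0" unfolding eigenvalue_of_def by blast
      then show "x = y" by simp
    qed
    then obtain M' where "M' ** ?M = mat 1"
      using matrix_left_invertible_injective by blast
    then have inv: "M' *v (?M *v w) = w" for w
      by (simp add: matrix_vector_mul_assoc)
    have "bounded_linear ((*v) M')"
      by (simp add: linear_conv_bounded_linear[symmetric] matrix_vector_mul_linear)
    then obtain K where K: "K > 0" "\<And>w. norm (M' *v w) \<le> norm w * K"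
      using bounded_linear.pos_bounded by blast
    have "norm (?T k v) \<le> (C * K) * \<rho> ^ k" for k
    proof -
      have "norm (?T k v) = norm (M' *v ?T k (A *v v - l *s v))"
        using inv[of "?T k v"] by (simp only: step M)
      also have "\<dots> \<le> norm (?T k (A *v v - l *s v)) * K" by (rule K)
      also have "\<dots> \<le> (C * \<rho> ^ k) * K" using C(3) K(1) by (simp add: mult_right_mono)
      finally show ?thesis by (simp add: mult_ac)
    qed
    then show ?thesis using C(1,2) by (auto simp: decays_under_def)
  qed
qed

text \<open>Over the complex numbers \<open>p\<close> splits, and each linear factor is removed by the previous lemma.
  Roots of \<open>p\<close> outside the open disc may occur, but they are not eigenvalues.\<close>

lemma decays_under_of_poly_action:
  assumes A: "\<And>l. eigenvalue_of A l \<Longrightarrow> cmod l < 1"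
  shows "p \<noteq> 0 \<Longrightarrow> decays_under A (poly_action A p v) \<Longrightarrow> decays_under A v"
proof (induction "degree p" arbitrary: p)
  case 0
  then obtain c where c: "p = [:c:]" "c \<noteq> 0"
    by (metis degree_eq_zeroE pCons_0_0)
  from 0 obtain C \<rho> where C: "0 < \<rho>" "\<rho> < 1"
    "\<And>k. norm (((*v) A ^^ k) (c *s v)) \<le> C * \<rho> ^ k"
    by (auto simp: c decays_under_def)
  have "norm (((*v) A ^^ k) v) \<le> (C / cmod c) * \<rho> ^ k" for k
    using C(3)[of k] c by (simp add: matrix_power_smult norm_vector_smult field_simps)
  then show ?case using C(1,2) unfolding decays_under_def by blast
next
  case (Suc n)
  have "\<not> constant (poly p)" using Suc.hyps(2) constant_degree[of p] by simp
  then obtain l where "poly p l = 0" using fundamental_theorem_of_algebra by blast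
  then obtain q where q: "p = [:-l, 1:] * q" by (metis dvdE poly_eq_0_iff_dvd)
  then have "q \<noteq> 0" using Suc by auto
  then have "degree p = Suc (degree q)" unfolding q by (subst degree_mult_eq) auto
  moreover have "decays_under A (poly_action A q v)"
    using Suc.prems(2) decays_under_linear_factor[OF A]
    unfolding q poly_action_linear_factor by blast
  ultimately show ?case using Suc.hyps \<open>q \<noteq> 0\<close> by simp
qed

lemma decays_under_zero: "decays_under A 0"
  unfolding decays_under_def
  by (intro exI[of _ 0] exI[of _ "1/2"]) (simp add: linear_0[OF matrix_power_linear])

lemma decays_under_if_spectrum_in_disc:
  assumes "\<And>l. eigenvalue_of A l \<Longrightarrow> cmod l < 1"
  shows "decays_under A v"
  using annihilating_polynomial_exists[of A v] decays_under_of_poly_action[OF assms]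
    decays_under_zero by metis

text \<open>The complex decay statement is applied to each vector of the standard basis; there are finitely
  many, so the worst rate and the sum of the constants serve all vectors at once.\<close>

lemma schur_stable_power_bound:
  fixes A :: "real^'n^'n"
  assumes "schur_stable A"
  obtains C \<rho> where "0 \<le> C" "0 < \<rho>" "\<rho> < 1"
    "\<And>k v. norm (((*v) A ^^ k) v) \<le> C * \<rho> ^ k * norm v"
proof -
  let ?T = "\<lambda>k. (*v) A ^^ k" and ?Ac = "map_matrix complex_of_real A"
  define cx :: "real^'n \<Rightarrow> complex^'n" where "cx v = (\<chi> i. of_real (v $ i))" for v
  have cx_norm: "norm (cx v) = norm v" for v
    by (simp add: cx_def norm_vec_def)
  have cx_mult: "?Ac *v cx v = cx (A *v v)" for v
    by (simp add: cx_def matrix_vector_mult_def map_matrix_def vec_eq_iff)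
  have cx_power: "((*v) ?Ac ^^ k) (cx v) = cx (?T k v)" for k v
    by (induction k) (auto simp: cx_mult)
  have "\<exists>C \<rho>. 0 < \<rho> \<and> \<rho> < 1 \<and> (\<forall>k. norm (?T k b) \<le> C * \<rho> ^ k)" for b
    using decays_under_if_spectrum_in_disc[of ?Ac "cx b"] assms
    by (simp add: schur_stable_def decays_under_def cx_power cx_norm)
  then obtain c \<rho> where c: "\<And>b. 0 < \<rho> b" "\<And>b. \<rho> b < 1" "\<And>b k. norm (?T k b) \<le> c b * \<rho> b ^ k"
    by metis
  define R where "R = Max (\<rho> ` Basis)"
  define D where "D = (\<Sum>b\<in>Basis. \<bar>c b\<bar>)"
  have R: "\<rho> b \<le> R" if "b \<in> Basis" for b
    using that by (simp add: R_def)
  have "R \<in> \<rho> ` Basis" unfolding R_def by (intro Max_in) auto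
  then have R01: "0 < R" "R < 1" using c by auto
  have "norm (?T k v) \<le> D * R ^ k * norm v" for k v
  proof -
    have "?T k v = ?T k (\<Sum>b\<in>Basis. (v \<bullet> b) *\<^sub>R b)"
      by (simp add: euclidean_representation)
    also have "\<dots> = (\<Sum>b\<in>Basis. (v \<bullet> b) *\<^sub>R ?T k b)"
      by (simp add: linear_sum[OF matrix_power_linear] linear_scale[OF matrix_power_linear])
    finally have "norm (?T k v) \<le> (\<Sum>b\<in>Basis. norm ((v \<bullet> b) *\<^sub>R ?T k b))"
      by (metis norm_sum)
    also have "\<dots> \<le> (\<Sum>b\<in>Basis. norm v * (\<bar>c b\<bar> * R ^ k))"
    proof (rule sum_mono)
      fix b :: "real^'n" assume b: "b \<in> Basis"
      have "norm (?T k b) \<le> c b * \<rho> b ^ k" by (rule c)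
      also have "\<dots> \<le> \<bar>c b\<bar> * R ^ k"
        using R[OF b] c(1)[of b] by (intro mult_mono power_mono) auto
      finally have "\<bar>v \<bullet> b\<bar> * norm (?T k b) \<le> norm v * (\<bar>c b\<bar> * R ^ k)"
        using Basis_le_norm[OF b, of v] by (intro mult_mono) auto
      then show "norm ((v \<bullet> b) *\<^sub>R ?T k b) \<le> norm v * (\<bar>c b\<bar> * R ^ k)" by simp
    qed
    also have "\<dots> = D * R ^ k * norm v"
      by (simp add: D_def sum_distrib_left sum_distrib_right mult_ac)
    finally show ?thesis .
  qed
  moreover have "0 \<le> D" by (simp add: D_def sum_nonneg)
  ultimately show ?thesis using R01 that by blast
qed

section \<open>Perturbed recursions with a Schur stable matrix\<close>

text \<open>Here \<open>b\<close> is the fixed point of the affine contraction that bounds one step.\<close>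

lemma affine_contraction_iterate:
  fixes y :: "nat \<Rightarrow> real"
  assumes "\<And>k. y (Suc k) \<le> \<rho> * y k + (1 - \<rho>) * b" "0 \<le> \<rho>"
  shows "y k \<le> \<rho> ^ k * (y 0 - b) + b"
proof (induction k)
  case (Suc k)
  have "\<rho> * y k \<le> \<rho> * (\<rho> ^ k * (y 0 - b) + b)" using Suc assms by (intro mult_left_mono)
  with assms(1)[of k] show ?case by (simp add: algebra_simps)
qed simp

text \<open>The perturbation may be proportional to \<open>y\<close> itself.  Once \<open>\<eta>\<close> is small it only degrades
  the rate from \<open>\<rho>\<close> to \<open>(1 + \<rho>) / 2\<close> and adds a forcing term as small as desired.\<close>

lemma vanishing_perturbation_of_contraction:
  fixes y \<eta> :: "nat \<Rightarrow> real"
  assumes step: "\<And>k. y (Suc k) \<le> \<rho> * y k + \<eta> k * (1 + y k)"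
    and y: "\<And>k. 0 \<le> y k" and \<rho>: "0 \<le> \<rho>" "\<rho> < 1" and \<eta>: "\<eta> \<longlonglongrightarrow> 0"
  shows "y \<longlonglongrightarrow> 0"
proof (rule LIMSEQ_I)
  fix \<delta> :: real assume \<delta>: "0 < \<delta>"
  \<comment> \<open>The first entry keeps the rate below \<open>\<sigma>\<close>, the second puts the fixed point of the perturbed
    contraction below \<open>\<delta> / 2\<close>.\<close>
  define h where "h = min ((1 - \<rho>) / 2) ((1 - \<rho>) * \<delta> / 4)"
  define \<sigma> where "\<sigma> = (1 + \<rho>) / 2"
  have h: "0 < h" "\<rho> + h \<le> \<sigma>" "h \<le> (1 - \<sigma>) * (\<delta> / 2)"
    using \<rho> \<delta> by (auto simp: h_def \<sigma>_def min_def field_simps)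
  have \<sigma>: "0 \<le> \<sigma>" "\<sigma> < 1" using \<rho> by (auto simp: \<sigma>_def)
  obtain K where K: "\<And>k. k \<ge> K \<Longrightarrow> \<eta> k \<le> h"
    using order_tendstoD(2)[OF \<eta> h(1)] unfolding eventually_sequentially
    by (meson less_imp_le)
  have "y (Suc k + K) \<le> \<sigma> * y (k + K) + (1 - \<sigma>) * (\<delta> / 2)" for k
  proof -
    have "\<eta> (k + K) * (1 + y (k + K)) \<le> h * (1 + y (k + K))"
      using K[of "k + K"] y[of "k + K"] by (intro mult_right_mono) auto
    then have "y (Suc k + K) \<le> (\<rho> + h) * y (k + K) + h"
      using step[of "k + K"] by (simp add: algebra_simps)
    also have "\<dots> \<le> \<sigma> * y (k + K) + (1 - \<sigma>) * (\<delta> / 2)"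
      using h y by (intro add_mono mult_right_mono)
    finally show ?thesis .
  qed
  from affine_contraction_iterate[of "\<lambda>k. y (k + K)", OF this \<sigma>(1)]
  have bound: "y (k + K) \<le> \<sigma> ^ k * (y K - \<delta> / 2) + \<delta> / 2" for k by simp
  have "(\<lambda>k. \<sigma> ^ k * (y K - \<delta> / 2)) \<longlonglongrightarrow> 0 * (y K - \<delta> / 2)"
    using \<sigma> by (intro tendsto_intros LIMSEQ_power_zero) auto
  then have "\<forall>\<^sub>F k in sequentially. \<sigma> ^ k * (y K - \<delta> / 2) < \<delta> / 2"
    using \<delta> by (intro order_tendstoD(2)) auto
  then obtain L where L: "\<And>k. k \<ge> L \<Longrightarrow> \<sigma> ^ k * (y K - \<delta> / 2) < \<delta> / 2"
    by (auto simp: eventually_sequentially)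
  show "\<exists>n0. \<forall>n\<ge>n0. norm (y n - 0) < \<delta>"
  proof (intro exI allI impI)
    fix n assume "n \<ge> L + K"
    then have "y n \<le> \<sigma> ^ (n - K) * (y K - \<delta> / 2) + \<delta> / 2" "L \<le> n - K"
      using bound[of "n - K"] by auto
    then have "y n < \<delta>" using L[of "n - K"] by linarith
    then show "norm (y n - 0) < \<delta>" using y[of n] by simp
  qed
qed

text \<open>Reduction of a vector recursion to a scalar one.  A Schur stable matrix need not be a contraction
  in the Euclidean norm, but it is one in the norm \<open>sup\<^sub>i \<rho>\<^sup>-\<^sup>i \<parallel>A\<^sup>i w\<parallel>\<close>.  The induction below bounds
  that norm of \<open>w\<^sub>k\<close> by \<open>y\<^sub>k\<close>, which is why it speaks about all powers of \<open>A\<close>.\<close>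

lemma stable_recursion_majorant:
  fixes A :: "real^'n^'n" and w g :: "nat \<Rightarrow> real^'n"
  assumes pow: "\<And>k v. norm (((*v) A ^^ k) v) \<le> C * \<rho> ^ k * norm v"
    and C: "0 \<le> C" "0 \<le> \<rho>"
    and w: "\<And>k. w (Suc k) = A *v w k + g k"
  obtains y where "\<And>k. norm (w k) \<le> y k" "\<And>k. 0 \<le> y k"
    "\<And>k. y (Suc k) = \<rho> * y k + C * norm (g k)"
proof
  define y where "y = rec_nat (C * norm (w 0)) (\<lambda>k t. \<rho> * t + C * norm (g k))"
  show y_Suc: "y (Suc k) = \<rho> * y k + C * norm (g k)" for k
    by (simp add: y_def)
  show "0 \<le> y k" for k
    using C by (induction k) (auto simp: y_def)
  have "norm (((*v) A ^^ i) (w k)) \<le> \<rho> ^ i * y k" for i k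
  proof (induction k arbitrary: i)
    case 0
    then show ?case using pow[of i "w 0"] by (simp add: y_def mult_ac)
  next
    case (Suc k)
    have "((*v) A ^^ i) (w (Suc k)) = ((*v) A ^^ Suc i) (w k) + ((*v) A ^^ i) (g k)"
      by (simp add: w linear_add[OF matrix_power_linear] flip: funpow_swap1)
    then have "norm (((*v) A ^^ i) (w (Suc k)))
        \<le> norm (((*v) A ^^ Suc i) (w k)) + norm (((*v) A ^^ i) (g k))"
      by (metis norm_triangle_ineq)
    also have "\<dots> \<le> \<rho> ^ Suc i * y k + C * \<rho> ^ i * norm (g k)"
      by (intro add_mono Suc pow)
    also have "\<dots> = \<rho> ^ i * y (Suc k)"
      by (simp add: y_Suc algebra_simps)
    finally show ?case .
  qed
  from this[of 0] show "norm (w k) \<le> y k" for k by simp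
qed

lemma stable_recursion_bounded:
  fixes A :: "real^'n^'n" and w g :: "nat \<Rightarrow> real^'n"
  assumes "schur_stable A" and w: "\<And>k. w (Suc k) = A *v w k + g k"
    and g: "\<And>k. norm (g k) \<le> G"
  obtains W where "\<And>k. norm (w k) \<le> W"
proof -
  obtain C \<rho> where C: "0 \<le> C" "0 < \<rho>" "\<rho> < 1"
    "\<And>k v. norm (((*v) A ^^ k) v) \<le> C * \<rho> ^ k * norm v"
    using schur_stable_power_bound[OF assms(1)] by metis
  obtain y where y: "\<And>k. norm (w k) \<le> y k" "\<And>k. y (Suc k) = \<rho> * y k + C * norm (g k)"
    using stable_recursion_majorant[of A C \<rho> w g, OF C(4) C(1) less_imp_le[OF C(2)] w] by metis
  define b where "b = C * G / (1 - \<rho>)"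
  have "y (Suc k) \<le> \<rho> * y k + (1 - \<rho>) * b" for k
    using C mult_left_mono[OF g[of k] C(1)] by (simp add: y b_def)
  from affine_contraction_iterate[of y, OF this]
  have "y k \<le> \<rho> ^ k * (y 0 - b) + b" for k using C by simp
  moreover have "\<rho> ^ k * (y 0 - b) \<le> \<bar>y 0 - b\<bar>" for k
  proof -
    have "\<rho> ^ k * (y 0 - b) \<le> \<rho> ^ k * \<bar>y 0 - b\<bar>"
      using C by (intro mult_left_mono) auto
    also have "\<dots> \<le> \<bar>y 0 - b\<bar>"
      using C by (intro mult_left_le_one_le power_le_one) auto
    finally show ?thesis .
  qed
  ultimately have "norm (w k) \<le> \<bar>y 0 - b\<bar> + b" for k
    using y(1)[of k] by (smt (verit))
  then show ?thesis by (rule that)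
qed

text \<open>Small-gain argument: the disturbance may grow linearly with the state, provided that
  its gain tends to zero.\<close>

lemma stable_recursion_vanishes:
  fixes A :: "real^'n^'n" and w g :: "nat \<Rightarrow> real^'n"
  assumes "schur_stable A" and w: "\<And>k. w (Suc k) = A *v w k + g k"
    and g: "\<And>k. norm (g k) \<le> \<eta> k * (1 + norm (w k))"
    and \<eta>: "\<eta> \<longlonglongrightarrow> 0" "\<And>k. 0 \<le> \<eta> k"
  shows "(\<lambda>k. norm (w k)) \<longlonglongrightarrow> 0"
proof -
  obtain C \<rho> where C: "0 \<le> C" "0 < \<rho>" "\<rho> < 1"
    "\<And>k v. norm (((*v) A ^^ k) v) \<le> C * \<rho> ^ k * norm v"
    using schur_stable_power_bound[OF assms(1)] by metis
  obtain y where y: "\<And>k. norm (w k) \<le> y k" "\<And>k. 0 \<le> y k"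
      "\<And>k. y (Suc k) = \<rho> * y k + C * norm (g k)"
    using stable_recursion_majorant[of A C \<rho> w g, OF C(4) C(1) less_imp_le[OF C(2)] w] by metis
  have "y (Suc k) \<le> \<rho> * y k + (C * \<eta> k) * (1 + y k)" for k
  proof -
    have "norm (g k) \<le> \<eta> k * (1 + y k)"
      using g[of k] mult_left_mono[of "1 + norm (w k)" "1 + y k" "\<eta> k"] y(1)[of k] \<eta>(2)[of k]
      by linarith
    from mult_left_mono[OF this C(1)] show ?thesis by (simp add: y(3) mult_ac)
  qed
  moreover have "(\<lambda>k. C * \<eta> k) \<longlonglongrightarrow> 0"
    using tendsto_mult_right_zero[OF \<eta>(1)] .
  ultimately have "y \<longlonglongrightarrow> 0"
    using vanishing_perturbation_of_contraction[of y \<rho> "\<lambda>k. C * \<eta> k"] y(2) C by simp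
  then show ?thesis
    by (rule Lim_null_comparison[rotated]) (simp add: y(1))
qed

section \<open>Rank-one updates in the Frobenius norm\<close>

text \<open>In the Frobenius inner product, pairing with a rank-one matrix is evaluation of the
  bilinear form.  All estimates on parameter matrices rest on this.\<close>

lemma inner_outer: "inner (outer v w) X = inner v (X *v w)"
  by (simp add: outer_def inner_vec_def matrix_vector_mult_def sum_distrib_left mult_ac)

lemma outer_mult_vector: "outer v w *v z = inner w z *\<^sub>R v"
  by (simp add: outer_def inner_vec_def matrix_vector_mult_def vec_eq_iff sum_distrib_left
      sum_distrib_right mult_ac)

lemma norm_outer: "norm (outer v w) = norm v * norm w"
proof -
  have "(norm (outer v w))\<^sup>2 = (norm v * norm w)\<^sup>2"
    by (simp add: power2_norm_eq_inner power_mult_distrib inner_outer outer_mult_vector)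
  then show ?thesis by simp
qed

text \<open>Testing \<open>X\<close> against the rank-one matrix \<open>(X w) w\<^sup>T\<close> turns Cauchy--Schwarz for matrices into
  this bound of the operator norm by the Frobenius norm.\<close>

lemma norm_matrix_vector_mult_le: "norm (X *v w) \<le> norm X * norm w" for X :: "real^'q^'m"
proof (cases "X *v w = 0")
  case False
  have "(norm (X *v w))\<^sup>2 = inner (outer (X *v w) w) X"
    by (simp add: inner_outer power2_norm_eq_inner)
  also have "\<dots> \<le> norm (X *v w) * norm w * norm X"
    by (metis norm_cauchy_schwarz norm_outer)
  finally show ?thesis
    using False by (simp add: power2_eq_square mult_ac)
qed simp

lemma norm_sq_scaleR_add:
  fixes x y :: "'a::real_inner"
  shows "(norm (a *\<^sub>R x + b *\<^sub>R y))\<^sup>2 = a\<^sup>2 * (norm x)\<^sup>2 + 2 * a * b * inner x y + b\<^sup>2 * (norm y)\<^sup>2"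
  unfolding power2_norm_eq_inner
  by (simp add: inner_add_left inner_add_right inner_commute power2_eq_square algebra_simps)

text \<open>The effect of one normalized gradient step on a squared distance.  Multiplying by \<open>N\<close> leaves the
  ratio \<open>\<parallel>\<phi>\<parallel>\<^sup>2 / N\<close>, which the normalization keeps in \<open>[0, 1]\<close>, as the only trace of the
  regressor's size.\<close>

lemma norm_sq_add_scaleR_outer:
  fixes X :: "real^'q^'m"
  assumes "N > 0"
  shows "N * (norm (X + (g / N) *\<^sub>R outer v \<phi>))\<^sup>2
    = N * (norm X)\<^sup>2 + 2 * g * inner v (X *v \<phi>) + g\<^sup>2 * ((norm \<phi>)\<^sup>2 / N) * (norm v)\<^sup>2"
proof -
  have "inner X (outer v \<phi>) = inner v (X *v \<phi>)"
    by (metis inner_commute inner_outer)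
  then have "(norm (X + (g / N) *\<^sub>R outer v \<phi>))\<^sup>2
    = (norm X)\<^sup>2 + 2 * (g / N) * inner v (X *v \<phi>) + (g / N)\<^sup>2 * (norm v * norm \<phi>)\<^sup>2"
    using norm_sq_scaleR_add[of 1 X "g / N" "outer v \<phi>"] by (simp add: norm_outer)
  then show ?thesis
    using assms by (simp add: field_simps power2_eq_square)
qed

section \<open>Energy dissipation of the high-order tuner\<close>

lemma young_deficit:
  fixes x y :: "'a::real_inner"
  assumes "D > 0"
  shows "2 * c * inner x y \<le> c\<^sup>2 / D * (norm x)\<^sup>2 + D * (norm y)\<^sup>2"
proof -
  have "0 \<le> (norm (c *\<^sub>R x - D *\<^sub>R y))\<^sup>2" by simp
  also have "\<dots> = c\<^sup>2 * (norm x)\<^sup>2 - 2 * c * D * inner x y + D\<^sup>2 * (norm y)\<^sup>2"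
    using norm_sq_scaleR_add[of c x "- D" y] by simp
  finally have "D * (2 * c * inner x y) \<le> D * (c\<^sup>2 / D * (norm x)\<^sup>2 + D * (norm y)\<^sup>2)"
    using assms by (simp add: algebra_simps power2_eq_square)
  then show ?thesis using assms by simp
qed

lemma norm_sq_sum3_le:
  fixes x y z :: "'a::real_inner"
  shows "(norm (x + y + z))\<^sup>2 \<le> 3 * ((norm x)\<^sup>2 + (norm y)\<^sup>2 + (norm z)\<^sup>2)"
proof -
  have "0 \<le> (norm (x - y))\<^sup>2 + (norm (y - z))\<^sup>2 + (norm (x - z))\<^sup>2" by simp
  then show ?thesis
    by (simp add: power2_norm_eq_inner algebra_simps inner_commute)
qed

text \<open>The energy \<open>V\<close> adds the squared distance of the auxiliary estimate \<open>X\<close> from the target \<open>S\<close> to the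
  squared distance between the two estimates.  The dissipation is best seen in two quantities
  other than \<open>\<epsilon>\<close>: the error \<open>\<epsilon>' = (T' - S) \<phi>\<close> of the updated
  parameter on the old regressor, and \<open>z = (Tb - X) \<phi>\<close>.  With \<open>s = \<parallel>\<phi>\<parallel>\<^sup>2 / N\<close>, expanding the
  squared distances gives an exact balance of \<open>N (V - V')\<close> in terms of \<open>\<epsilon>'\<close>, \<open>z\<close>, \<open>\<epsilon> + z\<close> and
  \<open>\<parallel>Tb - X\<parallel>\<^sup>2\<close>.  Because of
  \<open>s \<le> 1\<close> and \<open>\<parallel>z\<parallel>\<^sup>2 \<le> N \<parallel>Tb - X\<parallel>\<^sup>2\<close>, it contains at least \<open>2 \<gamma> (1 - \<gamma>) \<parallel>\<epsilon>'\<parallel>\<^sup>2\<close> and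
  \<open>\<beta> (2 - (1 + \<gamma>\<^sup>2) \<beta>) \<parallel>z\<parallel>\<^sup>2\<close>.  Completing the square with the mixed term
  \<open>-2 \<gamma> (2 - 3 \<beta>) \<epsilon>' \<bullet> z\<close> leaves exactly \<open>\<gamma> \<alpha> \<parallel>\<epsilon>'\<parallel>\<^sup>2\<close>, which is the origin of \<open>\<alpha>\<close>.

  The dissipation controls \<open>\<epsilon>\<close> itself, because \<open>\<epsilon>\<close> is a combination with bounded coefficients of
  \<open>\<epsilon>'\<close>, \<open>\<beta> z\<close> and \<open>s (\<epsilon> + z)\<close>, and a multiple of the square of each can be
  charged to it.\<close>

lemma tuner_energy_decrease:
  fixes T T' Tb X X' S :: "real^'q^'m" and \<phi> :: "real^'q" and \<epsilon> :: "real^'m"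
  assumes \<gamma>: "0 < \<gamma>"
    and D_pos: "0 < \<beta> * (2 - (1 + \<gamma>\<^sup>2) * \<beta>)"
    and N: "0 < N" "(norm \<phi>)\<^sup>2 \<le> N"
    and \<epsilon>: "\<epsilon> = (T - S) *v \<phi>"
    and Tb: "Tb = T - (\<gamma> * \<beta> / N) *\<^sub>R outer \<epsilon> \<phi>"
    and T': "T' = Tb - \<beta> *\<^sub>R (Tb - X)"
    and X': "X' = X - (\<gamma> / N) *\<^sub>R outer ((T' - T) *v \<phi> + \<epsilon>) \<phi>"
  defines "\<alpha> \<equiv> 2 * (1 - \<gamma>) - \<gamma> * (2 - 3 * \<beta>)\<^sup>2 / (\<beta> * (2 - (1 + \<gamma>\<^sup>2) * \<beta>))"
    and "V \<equiv> (norm (X - S))\<^sup>2 + (norm (T - X))\<^sup>2"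
    and "V' \<equiv> (norm (X' - S))\<^sup>2 + (norm (T' - X'))\<^sup>2"
  assumes \<alpha>: "0 < \<alpha>"
  shows "min (\<gamma> * \<alpha>) (min (2 * \<gamma>) 1) * (norm \<epsilon>)\<^sup>2 \<le> 3 * N * (V - V')"
proof -
  define D where "D = \<beta> * (2 - (1 + \<gamma>\<^sup>2) * \<beta>)"
  define s where "s = (norm \<phi>)\<^sup>2 / N"
  define z where "z = (Tb - X) *v \<phi>"
  define \<epsilon>' where "\<epsilon>' = (T' - S) *v \<phi>"
  define w where "w = \<epsilon> + z"
  have s: "0 \<le> s" "s \<le> 1" using N by (auto simp: s_def)
  have "0 \<le> \<gamma> * (2 - 3 * \<beta>)\<^sup>2 / D" using \<gamma> D_pos by (simp add: D_def)
  then have \<gamma>1: "\<gamma> < 1" using \<alpha> by (simp add: \<alpha>_def D_def)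
  have X'2: "X' = X - (\<gamma> / N) *\<^sub>R outer \<epsilon>' \<phi>"
    unfolding X' \<epsilon>'_def \<epsilon> by (simp add: algebra_simps)
  have q: "(T - X) *v \<phi> = z + (\<gamma> * \<beta> * s) *\<^sub>R \<epsilon>"
    by (simp add: z_def Tb s_def matrix_vector_mult_diff_rdistrib outer_mult_vector
        power2_norm_eq_inner flip: scaleR_matrix_vector_assoc)
  have T'X: "T' - X = (1 - \<beta>) *\<^sub>R (Tb - X)"
    unfolding T' by (simp add: algebra_simps)
  have XS: "(X - S) *v \<phi> = \<epsilon>' - (1 - \<beta>) *\<^sub>R z"
  proof -
    have "\<epsilon>' = (X - S) *v \<phi> + (T' - X) *v \<phi>"
      by (simp add: \<epsilon>'_def flip: matrix_vector_mult_add_rdistrib)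
    then show ?thesis
      by (simp add: T'X z_def scaleR_matrix_vector_assoc)
  qed
  \<comment> \<open>This relation stays implicit in \<open>\<epsilon>\<close>: solving it for \<open>\<epsilon>\<close> would bring the factor
    \<open>1 / (1 - \<gamma> \<beta> s)\<close> into all constants.\<close>
  have \<epsilon>_eq: "\<epsilon> = \<epsilon>' + \<beta> *\<^sub>R z + (\<gamma> * \<beta> * s) *\<^sub>R \<epsilon>"
  proof -
    have "\<epsilon> = (X - S) *v \<phi> + (T - X) *v \<phi>"
      by (simp add: \<epsilon> flip: matrix_vector_mult_add_rdistrib)
    then show ?thesis unfolding XS q by (simp add: algebra_simps)
  qed
  have E1: "N * (norm (X' - S))\<^sup>2 = N * (norm (X - S))\<^sup>2
      - 2 * \<gamma> * inner \<epsilon>' (\<epsilon>' - (1 - \<beta>) *\<^sub>R z) + \<gamma>\<^sup>2 * s * (norm \<epsilon>')\<^sup>2"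
    using norm_sq_add_scaleR_outer[OF N(1), of "X - S" "- \<gamma>" \<epsilon>' \<phi>]
    unfolding XS by (simp add: X'2 s_def diff_diff_eq add.commute)
  have E2: "N * (norm (T' - X'))\<^sup>2 = N * (1 - \<beta>)\<^sup>2 * (norm (Tb - X))\<^sup>2
      + 2 * \<gamma> * (1 - \<beta>) * inner \<epsilon>' z + \<gamma>\<^sup>2 * s * (norm \<epsilon>')\<^sup>2"
  proof -
    have "T' - X' = (1 - \<beta>) *\<^sub>R (Tb - X) + (\<gamma> / N) *\<^sub>R outer \<epsilon>' \<phi>"
      by (simp add: X'2 flip: T'X)
    then show ?thesis
      using norm_sq_add_scaleR_outer[OF N(1), of "(1 - \<beta>) *\<^sub>R (Tb - X)" \<gamma> \<epsilon>' \<phi>]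
      by (simp add: s_def power_mult_distrib z_def flip: scaleR_matrix_vector_assoc)
  qed
  have E3: "N * (norm (T - X))\<^sup>2 = N * (norm (Tb - X))\<^sup>2
      + 2 * (\<gamma> * \<beta>) * inner \<epsilon> z + (\<gamma> * \<beta>)\<^sup>2 * s * (norm \<epsilon>)\<^sup>2"
    using norm_sq_add_scaleR_outer[OF N(1), of "Tb - X" "\<gamma> * \<beta>" \<epsilon> \<phi>]
    by (simp add: Tb s_def z_def[unfolded Tb])
  \<comment> \<open>The implicit relation is used once only: the mixed term that it leaves on the right becomes
    part of \<open>\<parallel>\<epsilon> + z\<parallel>\<^sup>2\<close>.\<close>
  have \<epsilon>z: "inner \<epsilon> z = inner \<epsilon>' z + \<beta> * (norm z)\<^sup>2 + \<gamma> * \<beta> * s * inner \<epsilon> z"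
    by (subst \<epsilon>_eq) (simp add: inner_add_left power2_norm_eq_inner)
  have w: "(norm w)\<^sup>2 = (norm \<epsilon>)\<^sup>2 + 2 * inner \<epsilon> z + (norm z)\<^sup>2"
    by (simp add: w_def power2_norm_eq_inner algebra_simps inner_commute)
  have zN: "(norm z)\<^sup>2 \<le> N * (norm (Tb - X))\<^sup>2"
  proof -
    have "(norm z)\<^sup>2 \<le> (norm (Tb - X) * norm \<phi>)\<^sup>2"
      unfolding z_def by (intro power_mono norm_matrix_vector_mult_le) auto
    also have "\<dots> \<le> N * (norm (Tb - X))\<^sup>2"
      using mult_right_mono[OF N(2), of "(norm (Tb - X))\<^sup>2"]
      by (simp add: power_mult_distrib mult.commute)
    finally show ?thesis .
  qed
  have budget: "N * (V - V') = 2 * \<gamma> * (1 - \<gamma> * s) * (norm \<epsilon>')\<^sup>2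
      - 2 * (\<gamma> * (2 - 3 * \<beta>)) * inner \<epsilon>' z + 2 * \<gamma> * \<beta>\<^sup>2 * (norm z)\<^sup>2
      + (\<gamma> * \<beta>)\<^sup>2 * s * ((norm w)\<^sup>2 - (norm z)\<^sup>2) + \<beta> * (2 - \<beta>) * (N * (norm (Tb - X))\<^sup>2)"
  proof -
    have "N * (V - V') = N * (norm (X - S))\<^sup>2 + N * (norm (T - X))\<^sup>2
        - N * (norm (X' - S))\<^sup>2 - N * (norm (T' - X'))\<^sup>2"
      by (simp add: V_def V'_def algebra_simps)
    also have "\<dots> = 2 * \<gamma> * (1 - \<gamma> * s) * (norm \<epsilon>')\<^sup>2 - 4 * \<gamma> * (1 - \<beta>) * inner \<epsilon>' z
        + 2 * (\<gamma> * \<beta>) * inner \<epsilon> z + (\<gamma> * \<beta>)\<^sup>2 * s * (norm \<epsilon>)\<^sup>2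
        + \<beta> * (2 - \<beta>) * (N * (norm (Tb - X))\<^sup>2)"
      unfolding E1 E2 E3
      by (simp add: inner_diff_right flip: power2_norm_eq_inner)
         (simp add: algebra_simps power2_eq_square)
    also have "\<dots> = 2 * \<gamma> * (1 - \<gamma> * s) * (norm \<epsilon>')\<^sup>2
      - 2 * (\<gamma> * (2 - 3 * \<beta>)) * inner \<epsilon>' z + 2 * \<gamma> * \<beta>\<^sup>2 * (norm z)\<^sup>2
      + (\<gamma> * \<beta>)\<^sup>2 * s * ((norm w)\<^sup>2 - (norm z)\<^sup>2) + \<beta> * (2 - \<beta>) * (N * (norm (Tb - X))\<^sup>2)"
      using arg_cong[OF \<epsilon>z, of "\<lambda>t. 2 * (\<gamma> * \<beta>) * t"] unfolding w
      by (simp add: algebra_simps power2_eq_square)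
    finally show ?thesis .
  qed
  have lower: "\<gamma> * \<alpha> * (norm \<epsilon>')\<^sup>2 + 2 * \<gamma> * (norm (\<beta> *\<^sub>R z))\<^sup>2 + (\<gamma> * \<beta>)\<^sup>2 * s * (norm w)\<^sup>2
      \<le> N * (V - V')"
  proof -
    have "2 * \<gamma> * (1 - \<gamma>) * (norm \<epsilon>')\<^sup>2 \<le> 2 * \<gamma> * (1 - \<gamma> * s) * (norm \<epsilon>')\<^sup>2"
      using s \<gamma> by (intro mult_right_mono mult_left_mono) (auto simp: mult_left_le)
    moreover have "2 * (\<gamma> * (2 - 3 * \<beta>)) * inner \<epsilon>' z
        \<le> (\<gamma> * (2 - 3 * \<beta>))\<^sup>2 / D * (norm \<epsilon>')\<^sup>2 + D * (norm z)\<^sup>2"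
      using young_deficit D_pos unfolding D_def by blast
    moreover have "D * (norm z)\<^sup>2
        \<le> \<beta> * (2 - \<beta>) * (N * (norm (Tb - X))\<^sup>2) - (\<gamma> * \<beta>)\<^sup>2 * s * (norm z)\<^sup>2"
    proof -
      have "0 < D + (\<gamma> * \<beta>)\<^sup>2" using D_pos by (simp add: D_def add_pos_nonneg)
      then have "0 \<le> \<beta> * (2 - \<beta>)"
        by (simp add: D_def algebra_simps power2_eq_square)
      from mult_left_mono[OF zN this]
      have "\<beta> * (2 - \<beta>) * (norm z)\<^sup>2 \<le> \<beta> * (2 - \<beta>) * (N * (norm (Tb - X))\<^sup>2)" .
      moreover have "(\<gamma> * \<beta>)\<^sup>2 * s * (norm z)\<^sup>2 \<le> (\<gamma> * \<beta>)\<^sup>2 * 1 * (norm z)\<^sup>2"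
        using s by (intro mult_right_mono mult_left_mono) auto
      ultimately show ?thesis
        by (simp add: D_def algebra_simps power2_eq_square)
    qed
    moreover have "\<gamma> * \<alpha> * (norm \<epsilon>')\<^sup>2
        = 2 * \<gamma> * (1 - \<gamma>) * (norm \<epsilon>')\<^sup>2 - (\<gamma> * (2 - 3 * \<beta>))\<^sup>2 / D * (norm \<epsilon>')\<^sup>2"
      by (simp add: \<alpha>_def D_def algebra_simps power2_eq_square)
    moreover have "(norm (\<beta> *\<^sub>R z))\<^sup>2 = \<beta>\<^sup>2 * (norm z)\<^sup>2"
      by (simp add: power_mult_distrib)
    ultimately show ?thesis
      unfolding budget by (simp add: algebra_simps)
  qed
  \<comment> \<open>Substituting \<open>\<epsilon> = w - z\<close> only in the last term of the implicit relation keeps all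
    coefficients bounded.\<close>
  have upper: "(norm \<epsilon>)\<^sup>2
      \<le> 3 * ((norm \<epsilon>')\<^sup>2 + (norm (\<beta> *\<^sub>R z))\<^sup>2 + (\<gamma> * \<beta>)\<^sup>2 * s * (norm w)\<^sup>2)"
  proof -
    have "\<epsilon> = \<epsilon>' + (1 - \<gamma> * s) *\<^sub>R (\<beta> *\<^sub>R z) + (\<gamma> * \<beta> * s) *\<^sub>R w"
    proof -
      have "(\<gamma> * \<beta> * s) *\<^sub>R \<epsilon> = (\<gamma> * \<beta> * s) *\<^sub>R w - (\<gamma> * \<beta> * s) *\<^sub>R z"
        by (simp add: w_def algebra_simps)
      with \<epsilon>_eq have "\<epsilon> = \<epsilon>' + \<beta> *\<^sub>R z + ((\<gamma> * \<beta> * s) *\<^sub>R w - (\<gamma> * \<beta> * s) *\<^sub>R z)"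
        by metis
      then show ?thesis by (simp add: algebra_simps)
    qed
    then have sum3: "(norm \<epsilon>)\<^sup>2 \<le> 3 * ((norm \<epsilon>')\<^sup>2 + (norm ((1 - \<gamma> * s) *\<^sub>R (\<beta> *\<^sub>R z)))\<^sup>2
        + (norm ((\<gamma> * \<beta> * s) *\<^sub>R w))\<^sup>2)"
      by (metis norm_sq_sum3_le)
    have z_part: "(norm ((1 - \<gamma> * s) *\<^sub>R (\<beta> *\<^sub>R z)))\<^sup>2 \<le> (norm (\<beta> *\<^sub>R z))\<^sup>2"
    proof -
      have "0 \<le> \<gamma> * s" "\<gamma> * s \<le> 1" using s \<gamma> \<gamma>1 by (auto intro: mult_le_one)
      then have "norm ((1 - \<gamma> * s) *\<^sub>R (\<beta> *\<^sub>R z)) \<le> norm (\<beta> *\<^sub>R z)"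
        unfolding norm_scaleR[of "1 - \<gamma> * s"] by (intro mult_left_le_one_le) auto
      then show ?thesis by (intro power_mono) auto
    qed
    have w_part: "(norm ((\<gamma> * \<beta> * s) *\<^sub>R w))\<^sup>2 \<le> (\<gamma> * \<beta>)\<^sup>2 * s * (norm w)\<^sup>2"
    proof -
      have "(norm ((\<gamma> * \<beta> * s) *\<^sub>R w))\<^sup>2 = ((\<gamma> * \<beta>)\<^sup>2 * s * (norm w)\<^sup>2) * s"
        by (simp add: power_mult_distrib power2_eq_square)
      also have "\<dots> \<le> (\<gamma> * \<beta>)\<^sup>2 * s * (norm w)\<^sup>2"
        using s by (intro mult_left_le) auto
      finally show ?thesis .
    qed
    show ?thesis
      by (rule order_trans[OF sum3]) (intro mult_left_mono add_mono order_refl z_part w_part, simp)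
  qed
  \<comment> \<open>The smallest of the three dissipation rates; the third term has coefficient 1.\<close>
  define c where "c = min (\<gamma> * \<alpha>) (min (2 * \<gamma>) 1)"
  have c: "0 \<le> c" "c \<le> \<gamma> * \<alpha>" "c \<le> 2 * \<gamma>" "c \<le> 1"
    using \<gamma> \<alpha> by (auto simp: c_def)
  have "c * (norm \<epsilon>)\<^sup>2
      \<le> c * (3 * ((norm \<epsilon>')\<^sup>2 + (norm (\<beta> *\<^sub>R z))\<^sup>2 + (\<gamma> * \<beta>)\<^sup>2 * s * (norm w)\<^sup>2))"
    by (rule mult_left_mono[OF upper c(1)])
  also have "\<dots> = 3 * (c * (norm \<epsilon>')\<^sup>2 + c * (norm (\<beta> *\<^sub>R z))\<^sup>2 + c * ((\<gamma> * \<beta>)\<^sup>2 * s * (norm w)\<^sup>2))"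
    by (simp only: distrib_left mult_ac)
  also have "\<dots> \<le> 3 * (\<gamma> * \<alpha> * (norm \<epsilon>')\<^sup>2 + 2 * \<gamma> * (norm (\<beta> *\<^sub>R z))\<^sup>2
      + 1 * ((\<gamma> * \<beta>)\<^sup>2 * s * (norm w)\<^sup>2))"
    using c s by (intro mult_left_mono add_mono mult_right_mono) auto
  also have "\<dots> \<le> 3 * (N * (V - V'))" using lower by simp
  finally show ?thesis by (simp add: c_def)
qed

lemma decreasing_nonneg_differences_vanish:
  fixes V :: "nat \<Rightarrow> real"
  assumes "\<And>k. V (Suc k) \<le> V k" "\<And>k. 0 \<le> V k"
  shows "(\<lambda>k. V k - V (Suc k)) \<longlonglongrightarrow> 0"
proof -
  have "decseq V" using assms by (simp add: decseq_Suc_iff)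
  then obtain L where L: "V \<longlonglongrightarrow> L"
    using decseq_convergent[of V 0] assms by blast
  from tendsto_diff[OF L LIMSEQ_Suc[OF L]] show ?thesis by simp
qed

section \<open>Error dynamics and convergence\<close>

text \<open>Linear growth of the regressor in the state is what makes the normalization affordable: the
  bound on \<open>\<epsilon>\<^sup>2 / N\<close> becomes a bound on \<open>\<epsilon>\<close> that is affine in the state.\<close>

lemma regressor_norm_le:
  fixes f :: "'p::finite \<Rightarrow> real^'n \<Rightarrow> real"
  assumes lip: "\<And>i. (M i)-lipschitz_on UNIV (f i)" and f0: "\<And>i. f i 0 = 0"
  shows "(norm (regressor f x))\<^sup>2 \<le> (1 + (\<Sum>i\<in>UNIV. (M i)\<^sup>2)) * (norm x)\<^sup>2"
proof -
  have "(norm (regressor f x))\<^sup>2 = (\<Sum>s\<in>UNIV. (regressor f x $ s)\<^sup>2)"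
    by (simp add: norm_vec_def L2_set_def sum_nonneg)
  also have "\<dots> = (\<Sum>i\<in>UNIV. (x $ i)\<^sup>2) + (\<Sum>j\<in>UNIV. (f j x)\<^sup>2)"
    by (simp add: regressor_def sum.Plus o_def flip: UNIV_Plus_UNIV)
  also have "(\<Sum>i\<in>UNIV. (x $ i)\<^sup>2) = (norm x)\<^sup>2"
    by (simp add: norm_vec_def L2_set_def sum_nonneg)
  also have "(\<Sum>j\<in>UNIV. (f j x)\<^sup>2) \<le> (\<Sum>j\<in>UNIV. (M j)\<^sup>2 * (norm x)\<^sup>2)"
  proof (rule sum_mono)
    fix j
    have "\<bar>f j x\<bar> \<le> M j * norm x"
      using lipschitz_on_normD[OF lip[of j], of x 0] f0 by simp
    then have "\<bar>f j x\<bar>\<^sup>2 \<le> (M j * norm x)\<^sup>2" by (intro power_mono) auto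
    then show "(f j x)\<^sup>2 \<le> (M j)\<^sup>2 * (norm x)\<^sup>2" by (simp add: power_mult_distrib)
  qed
  finally show ?thesis by (simp add: sum_distrib_right distrib_right)
qed

text \<open>The parameter matrix \<open>[K, a\<^sub>1, \<dots>, a\<^sub>p]\<close> for which the controller would reproduce the reference
  model exactly.\<close>

definition ideal_gain :: "real^'n^'m \<Rightarrow> ('p::finite \<Rightarrow> real^'m) \<Rightarrow> real^('n + 'p)^'m" where
  "ideal_gain K a = (\<chi> i s. case s of Inl j \<Rightarrow> K $ i $ j | Inr j \<Rightarrow> a j $ i)"

lemma ideal_gain_mult_regressor:
  "ideal_gain K a *v regressor f x = K *v x - (\<Sum>i\<in>UNIV. f i x *\<^sub>R a i)"
  by (simp add: vec_eq_iff ideal_gain_def regressor_def matrix_vector_mult_def sum.Plus o_def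
      sum_negf mult.commute flip: UNIV_Plus_UNIV)

text \<open>Independent columns make the Gram matrix \<open>B\<^sup>T B\<close> injective, since
  \<open>d \<bullet> (B\<^sup>T B d) = \<parallel>B d\<parallel>\<^sup>2\<close>.\<close>

lemma left_pseudoinverse:
  fixes B :: "real^'m^'n"
  assumes "lin_indep_columns B"
  shows "matrix_inv (transpose B ** B) *v (transpose B *v (B *v y)) = y"
proof -
  let ?G = "transpose B ** B"
  have "inj ((*v) ?G)"
  proof (rule injI)
    fix x y assume eq: "?G *v x = ?G *v y"
    let ?d = "x - y"
    have "transpose B *v (B *v ?d) = 0"
      using eq by (simp add: matrix_vector_mul_assoc matrix_vector_mult_diff_distrib)
    then have "inner ?d (transpose B *v (B *v ?d)) = 0" by simp
    then have "inner (B *v ?d) (B *v ?d) = 0"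
      by (metis dot_lmul_matrix inner_commute transpose_matrix_vector)
    then have "B *v ?d = 0" by simp
    then have "(\<Sum>j\<in>UNIV. ?d $ j *s column j B) = 0"
      by (simp only: matrix_mult_sum)
    with assms have "\<forall>j. ?d $ j = 0" unfolding lin_indep_columns_def by blast
    then show "x = y" by (simp add: vec_eq_iff)
  qed
  then have "invertible ?G"
    by (simp add: invertible_left_inverse matrix_left_invertible_injective)
  then have "matrix_inv ?G ** ?G = mat 1"
    unfolding matrix_inv_def invertible_def by (rule someI2_ex) simp
  then show ?thesis
    by (simp add: matrix_vector_mul_assoc flip: matrix_mul_assoc)
qed

theorem theorem2:
  fixes Ap Am :: "real^'n^'n"
    and B :: "real^'m^'n"
    and a :: "'p::finite \<Rightarrow> real^'m"
    and f :: "'p \<Rightarrow> real^'n \<Rightarrow> real"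
    and M :: "'p \<Rightarrow> real"
    and \<mu> \<beta> \<gamma> r_max :: real
    and xp xm e :: "nat \<Rightarrow> real^'n"
    and r u \<epsilon> :: "nat \<Rightarrow> real^'m"
    and \<phi> :: "nat \<Rightarrow> real^('n + 'p)"
    and N :: "nat \<Rightarrow> real"
    and \<Theta> \<Theta>_bar \<Xi> :: "nat \<Rightarrow> real^('n + 'p)^'m"
  assumes "schur_stable Am"
    and "controllable Ap B"
    and "lin_indep_columns B"
    and "\<And>i. (M i)-lipschitz_on UNIV (f i)"
    and "\<And>i. f i 0 = 0"
    and "\<exists>K :: real^'n^'m. Am = Ap + B ** K"
    and "\<mu> > 0"
    and "0 < \<beta>" and "\<beta> < 2"
    and "0 < \<gamma>" and "\<gamma> < sqrt ((2 - \<beta>) / \<beta>)"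
    and "2 * (1 - \<gamma>) - \<gamma> * (2 - 3 * \<beta>)^2 / (\<beta> * (2 - (1 + \<gamma>^2) * \<beta>)) > 0"
    and "\<And>k. norm (r k) \<le> r_max"
    and "\<And>k. xp (Suc k) = Ap *v xp k + B *v ((\<Sum>i\<in>UNIV. f i (xp k) *\<^sub>R a i) + u k)"
    and "\<And>k. xm (Suc k) = Am *v xm k + B *v r k"
    and "\<And>k. e k = xp k - xm k"
    and "\<And>k. \<phi> k = regressor f (xp k)"
    and "\<And>k. u k = \<Theta> k *v \<phi> k + r k"
    and "\<And>k. \<epsilon> (Suc k) =
          matrix_inv (transpose B ** B) *v (transpose B *v (e (Suc k) - Am *v e k))"
    and "\<And>k. N k = max \<mu> ((norm (\<phi> k))^2)"
    and "\<Xi> 0 = \<Theta> 0"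
    and "\<And>k. \<Theta>_bar k = \<Theta> k - (\<gamma> * \<beta> / N k) *\<^sub>R outer (\<epsilon> (Suc k)) (\<phi> k)"
    and "\<And>k. \<Theta> (Suc k) = \<Theta>_bar k - \<beta> *\<^sub>R (\<Theta>_bar k - \<Xi> k)"
    and "\<And>k. \<Xi> (Suc k) =
          \<Xi> k - (\<gamma> / N k) *\<^sub>R outer ((\<Theta> (Suc k) - \<Theta> k) *v \<phi> k + \<epsilon> (Suc k)) (\<phi> k)"
  shows "(\<lambda>k. norm (e k)) \<longlonglongrightarrow> 0"
proof -
  note stable = assms(1) and indep = assms(3) and lip = assms(4) and f0 = assms(5)
    and \<mu> = assms(7) and r = assms(13) and xp = assms(14) and xm = assms(15) and e = assms(16)
    and \<phi> = assms(17) and u = assms(18) and \<epsilon> = assms(19) and N = assms(20)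
    and \<Theta>_bar = assms(22) and \<Theta> = assms(23) and \<Xi> = assms(24)
  obtain K :: "real^'n^'m" where K: "Am = Ap + B ** K" using assms(6) by blast
  define S where "S = ideal_gain K a"
  define \<alpha> where
    "\<alpha> = 2 * (1 - \<gamma>) - \<gamma> * (2 - 3 * \<beta>)\<^sup>2 / (\<beta> * (2 - (1 + \<gamma>\<^sup>2) * \<beta>))"
  define c where "c = min (\<gamma> * \<alpha>) (min (2 * \<gamma>) 1)"
  define V where "V k = (norm (\<Xi> k - S))\<^sup>2 + (norm (\<Theta> k - \<Xi> k))\<^sup>2" for k
  have c_pos: "0 < c" using assms(10,12) by (simp add: c_def \<alpha>_def)
  have D_pos: "0 < \<beta> * (2 - (1 + \<gamma>\<^sup>2) * \<beta>)"
  proof -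
    have "\<gamma>\<^sup>2 < (sqrt ((2 - \<beta>) / \<beta>))\<^sup>2"
      using assms(10,11) by (intro power_strict_mono) auto
    then have "\<gamma>\<^sup>2 * \<beta> < 2 - \<beta>" using assms(8,9) by (simp add: field_simps)
    then have "0 < 2 - (1 + \<gamma>\<^sup>2) * \<beta>" by (simp add: algebra_simps)
    then show ?thesis using assms(8) by simp
  qed
  have e_Suc: "e (Suc k) = Am *v e k + B *v ((\<Theta> k - S) *v \<phi> k)" for k
  proof -
    have "Am *v xp k = Ap *v xp k + B *v (K *v xp k)"
      by (simp add: K matrix_vector_mult_add_rdistrib matrix_vector_mul_assoc)
    then show ?thesis
      by (simp add: e xp xm u \<phi> S_def ideal_gain_mult_regressor algebra_simps)
  qed
  have \<epsilon>_eq: "\<epsilon> (Suc k) = (\<Theta> k - S) *v \<phi> k" for k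
    unfolding \<epsilon> e_Suc add_diff_cancel_left' by (rule left_pseudoinverse[OF indep])
  have N_pos: "0 < N k" and N_ge: "(norm (\<phi> k))\<^sup>2 \<le> N k" for k
    using \<mu> by (auto simp: N)
  have decrease: "c * (norm (\<epsilon> (Suc k)))\<^sup>2 \<le> 3 * N k * (V k - V (Suc k))" for k
    unfolding c_def \<alpha>_def V_def
    by (rule tuner_energy_decrease[OF assms(10) D_pos N_pos N_ge \<epsilon>_eq \<Theta>_bar \<Theta> \<Xi> assms(12)])
  have V_mono: "V (Suc k) \<le> V k" for k
  proof -
    have "0 \<le> 3 * N k * (V k - V (Suc k))"
      using decrease[of k] c_pos by (meson less_imp_le mult_nonneg_nonneg order_trans zero_le_power2)
    then show ?thesis using N_pos[of k] by (simp add: zero_le_mult_iff)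
  qed
  define \<tau> where "\<tau> k = sqrt (3 / c * (V k - V (Suc k)))" for k
  have \<tau>_nonneg: "0 \<le> \<tau> k" for k
    using V_mono[of k] c_pos by (simp add: \<tau>_def)
  have "(\<lambda>k. V k - V (Suc k)) \<longlonglongrightarrow> 0"
    by (rule decreasing_nonneg_differences_vanish[of V, OF V_mono]) (simp add: V_def)
  from tendsto_real_sqrt[OF tendsto_mult_right_zero[OF this, of "3 / c"]]
  have \<tau>_lim: "\<tau> \<longlonglongrightarrow> 0" by (simp add: \<tau>_def[abs_def])
  have \<epsilon>_le: "norm (\<epsilon> (Suc k)) \<le> \<tau> k * sqrt (N k)" for k
  proof -
    have "(norm (\<epsilon> (Suc k)))\<^sup>2 \<le> 3 / c * (V k - V (Suc k)) * N k"
      using decrease[of k] c_pos by (simp add: field_simps)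
    then show ?thesis
      unfolding \<tau>_def real_sqrt_mult[symmetric] by (rule real_le_rsqrt)
  qed
  define L where "L = sqrt (1 + (\<Sum>i\<in>UNIV. (M i)\<^sup>2))"
  have L: "0 \<le> L" "L\<^sup>2 = 1 + (\<Sum>i\<in>UNIV. (M i)\<^sup>2)"
    by (auto simp: L_def sum_nonneg)
  have N_le: "sqrt (N k) \<le> sqrt \<mu> + L * norm (xp k)" for k
  proof -
    have "(norm (\<phi> k))\<^sup>2 \<le> (L * norm (xp k))\<^sup>2"
      using regressor_norm_le[OF lip f0, where x = "xp k"] by (simp add: \<phi> L power_mult_distrib)
    then have "N k \<le> \<mu> + (L * norm (xp k))\<^sup>2"
      using \<mu> by (auto simp: N intro: order_trans)
    then have "sqrt (N k) \<le> sqrt (\<mu> + (L * norm (xp k))\<^sup>2)" by simp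
    also have "\<dots> \<le> sqrt \<mu> + sqrt ((L * norm (xp k))\<^sup>2)"
      using \<mu> by (intro sqrt_add_le_add_sqrt) auto
    finally show ?thesis using L by simp
  qed
  obtain b where b: "0 < b" "\<And>v. norm (B *v v) \<le> norm v * b"
    using bounded_linear.pos_bounded[OF matrix_vector_mul_bounded_linear[of B]] by blast
  have Br: "norm (B *v r k) \<le> r_max * b" for k
    using b(2)[of "r k"] mult_right_mono[OF r[of k], of b] b(1) by linarith
  obtain X where X: "\<And>k. norm (xm k) \<le> X"
    using stable_recursion_bounded[where g = "\<lambda>k. B *v r k", OF stable xm Br] by blast
  have X_nonneg: "0 \<le> X" using X[of 0] norm_ge_zero order_trans by blast
  define H where "H = sqrt \<mu> + L * X + L"
  show ?thesis
  proof (rule stable_recursion_vanishes[where g = "\<lambda>k. B *v ((\<Theta> k - S) *v \<phi> k)", OF stable e_Suc])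
    show "norm (B *v ((\<Theta> k - S) *v \<phi> k)) \<le> (b * H * \<tau> k) * (1 + norm (e k))" for k
    proof -
      have "norm (xp k) \<le> norm (e k) + X"
        using norm_triangle_ineq[of "e k" "xm k"] X[of k] by (simp add: e)
      then have "L * norm (xp k) \<le> L * (norm (e k) + X)" using L by (intro mult_left_mono)
      moreover have "0 \<le> (sqrt \<mu> + L * X) * norm (e k)"
        using L X_nonneg \<mu> by simp
      ultimately have "sqrt (N k) \<le> H * (1 + norm (e k))"
        using N_le[of k] L by (simp add: H_def algebra_simps)
      then have "\<tau> k * sqrt (N k) \<le> \<tau> k * (H * (1 + norm (e k)))"
        by (intro mult_left_mono \<tau>_nonneg)
      with \<epsilon>_le[of k] have "norm (\<epsilon> (Suc k)) \<le> \<tau> k * (H * (1 + norm (e k)))" by linarith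
      then have "norm (\<epsilon> (Suc k)) * b \<le> \<tau> k * (H * (1 + norm (e k))) * b"
        using b(1) by (intro mult_right_mono) auto
      with b(2)[of "\<epsilon> (Suc k)"] show ?thesis by (simp add: \<epsilon>_eq mult_ac)
    qed
    show "(\<lambda>k. b * H * \<tau> k) \<longlonglongrightarrow> 0"
      by (rule tendsto_mult_right_zero[OF \<tau>_lim])
    show "0 \<le> b * H * \<tau> k" for k
      using b(1) L X_nonneg \<mu> \<tau>_nonneg[of k] by (simp add: H_def)
  qed
qed

end
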